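(* (In classical mathematics.) Let $A$ be a commutative ring, $\ell\ge 1$ an integer, and $J_1,\ldots,J_\ell,U_1,\ldots,U_\ell$ be $2\ell$ subsets of $A$. The following two properties are equivalent: (a) there do not exist $\ell$ prime ideals $P_1\subset\cdots\subset P_\ell$ of $A$ such that $J_i\subset P_i$ and $U_i\cap P_i=\emptyset$ for $i=1,\ldots,\ell$; (b) there exist, for $i=1,\ldots,\ell$, an element $j_i$ of the ideal generated by $J_i$ and an element $u_i$ of the multiplicative monoid generated by $U_i$ such that $$u_1(\ldots(u_\ell+j_\ell)+\ldots)+j_1=0.$$
   Context: Rings are commutative with unit. The symbol $\subset$ denotes inclusion in the wide sense. The monoid generated by $U_i$ is the multiplicative submonoid of $A$ generated by $U_i$ (it contains $1$). The nested expression is $u_1(u_2(\cdots(u_{\ell-1}(u_\ell+j_\ell)+j_{\ell-1})\cdots)+j_2)+j_1$; for example for $\ell=3$ it is $u_1(u_2(u_3+j_3)+j_2)+j_1$. *)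

theory Defs
  imports "HOL-Algebra.Ideal"
begin

definition genmonoid :: "('a, 'b) monoid_scheme \<Rightarrow> 'a set \<Rightarrow> 'a set"
  where "genmonoid G U = \<Inter>{M. submonoid M G \<and> U \<subseteq> M}"

text \<open>The value is the intended one for \<open>l \<ge> 1\<close> only. The list \<open>[1..<l]\<close> is \<open>1, \<dots>, l - 1\<close>, and
  \<open>foldr\<close> wraps the innermost term \<open>u l + j l\<close> successively, with index \<open>1\<close> outermost.\<close>

definition nested :: "('a, 'b) ring_scheme \<Rightarrow> (nat \<Rightarrow> 'a) \<Rightarrow> (nat \<Rightarrow> 'a) \<Rightarrow> nat \<Rightarrow> 'a"
  where "nested A u j l =
    foldr (\<lambda>i x. (u i \<otimes>\<^bsub>A\<^esub> x) \<oplus>\<^bsub>A\<^esub> j i) [1..<l] (u l \<oplus>\<^bsub>A\<^esub> j l)"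

lemma nested_1: "nested A u j 1 = u 1 \<oplus>\<^bsub>A\<^esub> j 1"
  by (simp add: nested_def)

lemma nested_3:
  "nested A u j 3 =
    (u 1 \<otimes>\<^bsub>A\<^esub> ((u 2 \<otimes>\<^bsub>A\<^esub> (u 3 \<oplus>\<^bsub>A\<^esub> j 3)) \<oplus>\<^bsub>A\<^esub> j 2)) \<oplus>\<^bsub>A\<^esub> j 1"
  by (simp add: nested_def upt_rec numeral_2_eq_2)

end

theory Submission
  imports Defs "HOL-Algebra.Ring_Divisibility"
begin

text \<open>
  Write \<open>I\<^sub>i\<close> for the ideal generated by \<open>J\<^sub>i\<close> and \<open>M\<^sub>i\<close> for the monoid generated by \<open>U\<^sub>i\<close>, and let
  \<open>S\<^sub>i\<close> be the set of values of the inner expressions starting at index \<open>i\<close>, so that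
  \<open>S\<^sub>i = M\<^sub>i S\<^bsub>i+1\<^esub> + I\<^sub>i\<close> and \<open>S\<^bsub>l+1\<^esub> = {1}\<close>. Property (b) says that \<open>0 \<in> S\<^sub>1\<close>.

  If a chain of primes exists, then \<open>S\<^sub>i\<close> is disjoint from \<open>P\<^sub>i\<close>, by descending induction on \<open>i\<close>:
  \<open>S\<^bsub>i+1\<^esub>\<close> avoids \<open>P\<^bsub>i+1\<^esub>\<close>, hence the smaller \<open>P\<^sub>i\<close>, so \<open>M\<^sub>i S\<^bsub>i+1\<^esub>\<close> avoids the prime \<open>P\<^sub>i\<close>, and adding
  elements of \<open>I\<^sub>i \<subseteq> P\<^sub>i\<close> does not change this (\<open>extension_disjoint_primeideal\<close>). In particular
  \<open>0 \<notin> S\<^sub>1\<close>.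

  For the converse the point is that every \<open>S\<^sub>i\<close> is itself a multiplicative submonoid
  (\<open>extension_submonoid\<close>). Suppose \<open>0 \<notin> S\<^sub>1\<close> and put \<open>P\<^sub>0 = {0}\<close>. If \<open>P\<^bsub>i-1\<^esub>\<close> has been
  found disjoint from \<open>S\<^sub>i = M\<^sub>i S\<^bsub>i+1\<^esub> + I\<^sub>i\<close>, then the ideal \<open>P\<^bsub>i-1\<^esub> + I\<^sub>i\<close> is disjoint from the submonoid
  \<open>M\<^sub>i S\<^bsub>i+1\<^esub>\<close>, and Krull's lemma (\<open>exists_primeideal_disjoint\<close>) enlarges it to a prime \<open>P\<^sub>i\<close> still
  disjoint from \<open>M\<^sub>i S\<^bsub>i+1\<^esub>\<close>. Thus \<open>P\<^sub>i\<close> avoids \<open>M\<^sub>i\<close>, and it avoids \<open>S\<^bsub>i+1\<^esub>\<close>, which is what is needed to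
  continue (\<open>exists_primeideal_step\<close>). So the chain is built upwards by a greedy choice.
\<close>

section \<open>Prime ideals and multiplicative submonoids\<close>

text \<open>Krull's lemma: an ideal maximal among those disjoint from \<open>S\<close> is prime. If \<open>a\<close> and \<open>b\<close> lie
  outside it, both \<open>Q + (a)\<close> and \<open>Q + (b)\<close> meet \<open>S\<close>, and the product of two such elements of \<open>S\<close>
  lies in \<open>Q + (ab)\<close>, so that \<open>ab\<close> cannot lie in \<open>Q\<close>.\<close>

lemma (in cring) exists_primeideal_disjoint:
  assumes I: "ideal I R" and S: "submonoid S R" and disj: "I \<inter> S = {}"
  shows "\<exists>Q. primeideal Q R \<and> I \<subseteq> Q \<and> Q \<inter> S = {}"
proof -
  define F where "F = {K. ideal K R \<and> I \<subseteq> K \<and> K \<inter> S = {}}"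
  have "\<exists>Q\<in>F. \<forall>K\<in>F. Q \<subseteq> K \<longrightarrow> K = Q"
  proof (rule subset_Zorn_nonempty)
    show "F \<noteq> {}" using I disj by (auto simp: F_def)
  next
    fix C assume C: "C \<noteq> {}" "subset.chain F C"
    then have "subset.chain {K. ideal K R} C"
      unfolding pred_on.chain_def F_def by blast
    from chain_Union_is_ideal[OF this] C(1) have "ideal (\<Union>C) R" by simp
    with C show "\<Union>C \<in> F"
      unfolding pred_on.chain_def F_def by blast
  qed
  then obtain Q where QF: "Q \<in> F" and QF_max: "\<forall>K\<in>F. Q \<subseteq> K \<longrightarrow> K = Q"
    by blast
  from QF have Q: "ideal Q R" "I \<subseteq> Q" "Q \<inter> S = {}"
    by (simp_all add: F_def)
  have max: "K = Q" if "ideal K R" "I \<subseteq> K" "K \<inter> S = {}" "Q \<subseteq> K" for K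
    using QF_max that by (simp add: F_def)
  interpret Q: ideal Q R by fact
  interpret S: submonoid S R by fact
  have meets: "\<exists>q\<in>Q. \<exists>r\<in>carrier R. q \<oplus> r \<otimes> a \<in> S" if a: "a \<in> carrier R" "a \<notin> Q" for a
  proof -
    have Qa: "ideal (Q <+>\<^bsub>R\<^esub> PIdl a) R"
      using Q(1) cgenideal_ideal[OF a(1)] by (rule add_ideals)
    have sub: "Q \<union> PIdl a \<subseteq> Q <+>\<^bsub>R\<^esub> PIdl a"
      using union_genideal[OF Q(1) cgenideal_ideal[OF a(1)]] genideal_self[of "Q \<union> PIdl a"]
        Q.a_subset cgenideal_ideal[OF a(1), THEN ideal.Icarr] by auto
    have "(Q <+>\<^bsub>R\<^esub> PIdl a) \<inter> S \<noteq> {}"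
      using max[OF Qa] sub Q(2) cgenideal_self[OF a(1)] a(2) by blast
    then show ?thesis
      unfolding set_add_def' cgenideal_def by blast
  qed
  have "primeideal Q R"
  proof (rule primeidealI[OF Q(1) is_cring])
    show "carrier R \<noteq> Q" using Q(3) S.one_closed S.subset by blast
  next
    fix a b assume ab: "a \<in> carrier R" "b \<in> carrier R" "a \<otimes> b \<in> Q"
    show "a \<in> Q \<or> b \<in> Q"
    proof (rule ccontr)
      assume "\<not> (a \<in> Q \<or> b \<in> Q)"
      with meets ab obtain q r q' r' where
        q: "q \<in> Q" "r \<in> carrier R" "q \<oplus> r \<otimes> a \<in> S" and
        q': "q' \<in> Q" "r' \<in> carrier R" "q' \<oplus> r' \<otimes> b \<in> S" by meson
      have c: "q \<in> carrier R" "q' \<in> carrier R" using q q' Q.Icarr by auto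
      have "(q \<oplus> r \<otimes> a) \<otimes> (q' \<oplus> r' \<otimes> b)
          = q \<otimes> (q' \<oplus> r' \<otimes> b) \<oplus> ((r \<otimes> a) \<otimes> q' \<oplus> (r \<otimes> r') \<otimes> (a \<otimes> b))"
        using c q q' ab by algebra
      also have "\<dots> \<in> Q"
        using c q q' ab Q.I_r_closed[of q "q' \<oplus> r' \<otimes> b"] Q.I_l_closed[of q' "r \<otimes> a"]
          Q.I_l_closed[of "a \<otimes> b" "r \<otimes> r'"] by (intro Q.a_closed) auto
      finally show False using S.m_closed[OF q(3) q'(3)] Q(3) by blast
    qed
  qed
  with Q show ?thesis by blast
qed

lemma (in monoid) genmonoid_submonoid:
  assumes "U \<subseteq> carrier G"
  shows "submonoid (genmonoid G U) G"
proof
  show "genmonoid G U \<subseteq> carrier G"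
    using assms unfolding genmonoid_def by (auto simp: submonoid_def)
qed (auto simp: genmonoid_def submonoid_def)

lemma genmonoid_superset: "U \<subseteq> genmonoid G U"
  by (auto simp: genmonoid_def)

text \<open>The complement of a prime ideal is a submonoid.\<close>

lemma (in primeideal) genmonoid_disjoint:
  assumes "U \<subseteq> carrier R" "U \<inter> I = {}"
  shows "genmonoid R U \<inter> I = {}"
proof -
  have "submonoid (carrier R - I) R"
    using I_prime I_notcarr one_imp_carrier by unfold_locales auto
  then have "genmonoid R U \<subseteq> carrier R - I"
    using assms unfolding genmonoid_def by blast
  then show ?thesis by blast
qed

section \<open>The sets of values of nested expressions\<close>

definition extension :: "('a, 'b) ring_scheme \<Rightarrow> 'a set \<Rightarrow> 'a set \<Rightarrow> 'a set \<Rightarrow> 'a set"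
  where "extension R M I X = {(u \<otimes>\<^bsub>R\<^esub> x) \<oplus>\<^bsub>R\<^esub> j | u x j. u \<in> M \<and> x \<in> X \<and> j \<in> I}"

text \<open>In a product of two elements of \<open>M X + I\<close> all terms but \<open>(u u') (x x')\<close> are absorbed by \<open>I\<close>.
  This is why Krull's lemma applies again at every level of the nested expression.\<close>

lemma (in cring) extension_submonoid:
  assumes "submonoid M R" "ideal I R" "submonoid X R"
  shows "submonoid (extension R M I X) R"
proof -
  interpret M: submonoid M R by fact
  interpret X: submonoid X R by fact
  interpret I: ideal I R by fact
  show ?thesis
  proof
    show "extension R M I X \<subseteq> carrier R"
      by (auto simp: extension_def)
    have "\<one> = \<one> \<otimes> \<one> \<oplus> \<zero>" by simp
    then show "\<one> \<in> extension R M I X"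
      unfolding extension_def using M.one_closed X.one_closed I.zero_closed by blast
  next
    fix y y' assume "y \<in> extension R M I X" "y' \<in> extension R M I X"
    then obtain u x j u' x' j' where
      y: "u \<in> M" "x \<in> X" "j \<in> I" "y = u \<otimes> x \<oplus> j" and
      y': "u' \<in> M" "x' \<in> X" "j' \<in> I" "y' = u' \<otimes> x' \<oplus> j'"
      unfolding extension_def by blast
    have "y \<otimes> y' = (u \<otimes> u') \<otimes> (x \<otimes> x') \<oplus> ((u \<otimes> x) \<otimes> j' \<oplus> j \<otimes> (u' \<otimes> x' \<oplus> j'))"
      unfolding y(4) y'(4)
      using M.mem_carrier[OF y(1)] X.mem_carrier[OF y(2)] I.Icarr[OF y(3)]
        M.mem_carrier[OF y'(1)] X.mem_carrier[OF y'(2)] I.Icarr[OF y'(3)]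
      by algebra
    moreover have "(u \<otimes> x) \<otimes> j' \<oplus> j \<otimes> (u' \<otimes> x' \<oplus> j') \<in> I"
      using y y' by (intro I.a_closed I.I_l_closed I.I_r_closed) auto
    ultimately show "y \<otimes> y' \<in> extension R M I X"
      unfolding extension_def using y y' M.m_closed X.m_closed by blast
  qed
qed

text \<open>One step of the construction of the chain: an element \<open>u x\<close> of \<open>M X\<close> lying in \<open>P + I\<close> would,
  after subtracting its component in \<open>I\<close>, be an element of \<open>M X + I\<close> lying in \<open>P\<close>. So \<open>P + I\<close> is
  disjoint from \<open>M X\<close>, which contains both \<open>M\<close> and \<open>X\<close>.\<close>

lemma (in cring) exists_primeideal_step:
  assumes P: "ideal P R" and I: "ideal I R" and M: "submonoid M R" and X: "submonoid X R"
    and disj: "P \<inter> extension R M I X = {}"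
  shows "\<exists>Q. primeideal Q R \<and> P \<subseteq> Q \<and> I \<subseteq> Q \<and> Q \<inter> M = {} \<and> Q \<inter> X = {}"
proof -
  interpret P: ideal P R by fact
  interpret I: ideal I R by fact
  interpret M: submonoid M R by fact
  interpret X: submonoid X R by fact
  define MX where "MX = extension R M {\<zero>} X"
  have MX: "submonoid MX R"
    unfolding MX_def using M zeroideal X by (rule extension_submonoid)
  have MX_I: "u \<otimes> x \<in> MX" if "u \<in> M" "x \<in> X" for u x
    using that unfolding MX_def extension_def by force
  have "(P <+>\<^bsub>R\<^esub> I) \<inter> MX = {}"
  proof (rule ccontr)
    assume "(P <+>\<^bsub>R\<^esub> I) \<inter> MX \<noteq> {}"
    then obtain p i u x where *: "p \<in> P" "i \<in> I" "u \<in> M" "x \<in> X" "p \<oplus> i = u \<otimes> x"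
      unfolding MX_def extension_def set_add_def' by force
    have "p = u \<otimes> x \<oplus> \<ominus> i"
      using * P.Icarr I.Icarr by (metis add.m_closed a_inv_closed add.inv_solve_right)
    then have "p \<in> extension R M I X"
      unfolding extension_def using * I.a_inv_closed by blast
    with \<open>p \<in> P\<close> disj show False by blast
  qed
  then obtain Q where Q: "primeideal Q R" "P <+>\<^bsub>R\<^esub> I \<subseteq> Q" "Q \<inter> MX = {}"
    using exists_primeideal_disjoint[OF add_ideals[OF P I] MX] by blast
  have "P \<union> I \<subseteq> P <+>\<^bsub>R\<^esub> I"
    using union_genideal[OF P I] genideal_self[of "P \<union> I"] P.a_subset I.a_subset by auto
  moreover have "M \<subseteq> MX" "X \<subseteq> MX"
    using MX_I[OF _ X.one_closed] MX_I[OF M.one_closed] by auto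
  ultimately show ?thesis using Q by blast
qed

lemma (in primeideal) extension_disjoint_primeideal:
  assumes "M \<subseteq> carrier R" "X \<subseteq> carrier R" "M \<inter> I = {}" "X \<inter> I = {}" "K \<subseteq> I"
  shows "extension R M K X \<inter> I = {}"
proof (rule ccontr)
  assume "extension R M K X \<inter> I \<noteq> {}"
  then obtain u x j where *: "u \<in> M" "x \<in> X" "j \<in> I" "u \<otimes> x \<oplus> j \<in> I"
    using assms(5) unfolding extension_def by blast
  have c: "u \<in> carrier R" "x \<in> carrier R" "j \<in> carrier R"
    using * assms Icarr by auto
  have "u \<otimes> x = (u \<otimes> x \<oplus> j) \<oplus> \<ominus> j"
    using c by algebra
  also have "\<dots> \<in> I"
    using * additive_subgroup.a_closed[OF is_additive_subgroup]
      additive_subgroup.a_inv_closed[OF is_additive_subgroup] by blast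
  finally show False using I_prime[OF c(1,2)] * assms by blast
qed

text \<open>Starting from \<open>{1}\<close> rather than from \<open>M + I\<close> at the innermost index makes all steps alike.\<close>

definition nested_values ::
  "('a, 'b) ring_scheme \<Rightarrow> (nat \<Rightarrow> 'a set) \<Rightarrow> (nat \<Rightarrow> 'a set) \<Rightarrow> nat list \<Rightarrow> 'a set"
  where "nested_values R M I ks = foldr (\<lambda>i. extension R (M i) (I i)) ks {\<one>\<^bsub>R\<^esub>}"

lemma nested_values_Nil [simp]: "nested_values R M I [] = {\<one>\<^bsub>R\<^esub>}"
  by (simp add: nested_values_def)

lemma nested_values_Cons [simp]:
  "nested_values R M I (k # ks) = extension R (M k) (I k) (nested_values R M I ks)"
  by (simp add: nested_values_def)

lemma (in cring) nested_values_submonoid: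
  assumes "\<And>i. i \<in> set ks \<Longrightarrow> submonoid (M i) R" "\<And>i. i \<in> set ks \<Longrightarrow> ideal (I i) R"
  shows "submonoid (nested_values R M I ks) R"
  using assms
proof (induction ks)
  case Nil
  show ?case by unfold_locales auto
qed (auto intro: extension_submonoid)

text \<open>Distinctness of the indices is what allows the elements \<open>u\<close> and \<open>j\<close> chosen at the separate
  stages to be collected into two functions of the index.\<close>

lemma nested_values_iff:
  assumes "distinct ks"
  shows "y \<in> nested_values R M I ks \<longleftrightarrow>
    (\<exists>j u. (\<forall>i\<in>set ks. j i \<in> I i \<and> u i \<in> M i) \<and>
      y = foldr (\<lambda>i x. (u i \<otimes>\<^bsub>R\<^esub> x) \<oplus>\<^bsub>R\<^esub> j i) ks \<one>\<^bsub>R\<^esub>)"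
  using assms
proof (induction ks arbitrary: y)
  case Nil
  show ?case by simp
next
  case (Cons k ks)
  let ?f = "\<lambda>j u. foldr (\<lambda>i x. (u i \<otimes>\<^bsub>R\<^esub> x) \<oplus>\<^bsub>R\<^esub> j i)"
  have IH: "x \<in> nested_values R M I ks \<longleftrightarrow>
      (\<exists>j u. (\<forall>i\<in>set ks. j i \<in> I i \<and> u i \<in> M i) \<and> x = ?f j u ks \<one>\<^bsub>R\<^esub>)" for x
    using Cons by simp
  show ?case
  proof
    assume "y \<in> nested_values R M I (k # ks)"
    then obtain j u j0 u0 where
      *: "\<forall>i\<in>set ks. j i \<in> I i \<and> u i \<in> M i" "j0 \<in> I k" "u0 \<in> M k"
      "y = (u0 \<otimes>\<^bsub>R\<^esub> ?f j u ks \<one>\<^bsub>R\<^esub>) \<oplus>\<^bsub>R\<^esub> j0"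
      unfolding nested_values_Cons extension_def using IH by auto
    have "?f (j(k := j0)) (u(k := u0)) ks \<one>\<^bsub>R\<^esub> = ?f j u ks \<one>\<^bsub>R\<^esub>"
      using Cons.prems by (intro foldr_cong) auto
    then show "\<exists>j u. (\<forall>i\<in>set (k # ks). j i \<in> I i \<and> u i \<in> M i) \<and> y = ?f j u (k # ks) \<one>\<^bsub>R\<^esub>"
      using * Cons.prems by (intro exI[of _ "j(k := j0)"] exI[of _ "u(k := u0)"]) auto
  next
    assume "\<exists>j u. (\<forall>i\<in>set (k # ks). j i \<in> I i \<and> u i \<in> M i) \<and> y = ?f j u (k # ks) \<one>\<^bsub>R\<^esub>"
    then show "y \<in> nested_values R M I (k # ks)"
      unfolding nested_values_Cons extension_def using IH by force
  qed
qed

lemma (in ring) nested_eq_foldr_one: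
  assumes "l \<ge> 1" "u l \<in> carrier R"
  shows "nested R u j l = foldr (\<lambda>i x. (u i \<otimes> x) \<oplus> j i) [1..<Suc l] \<one>"
  using assms unfolding nested_def by simp

section \<open>Chains of prime ideals\<close>

text \<open>The greedy construction. Index \<open>0\<close> of the chain holds the zero ideal, which turns the
  hypothesis on \<open>\<zero>\<close> into the start of the induction.\<close>

lemma (in cring) exists_primeideal_chain:
  assumes I: "\<And>i. i \<in> {1..l} \<Longrightarrow> ideal (I i) R"
    and M: "\<And>i. i \<in> {1..l} \<Longrightarrow> submonoid (M i) R"
    and zero: "\<zero> \<notin> nested_values R M I [1..<Suc l]"
  shows "\<exists>P. (\<forall>i\<in>{1..l}. primeideal (P i) R) \<and> (\<forall>i\<in>{1..<l}. P i \<subseteq> P (Suc i)) \<and>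
    (\<forall>i\<in>{1..l}. I i \<subseteq> P i \<and> M i \<inter> P i = {})"
proof -
  let ?S = "\<lambda>i. nested_values R M I [i..<Suc l]"
  have "\<exists>P. (\<forall>i\<in>{1..n}. primeideal (P i) R) \<and> (\<forall>i\<in>{1..<n}. P i \<subseteq> P (Suc i)) \<and>
      (\<forall>i\<in>{1..n}. I i \<subseteq> P i \<and> M i \<inter> P i = {}) \<and> ideal (P n) R \<and> P n \<inter> ?S (Suc n) = {}"
    if "n \<le> l" for n
    using that
  proof (induction n)
    case 0
    show ?case
      using zero zeroideal by (intro exI[of _ "\<lambda>_. {\<zero>}"]) auto
  next
    case (Suc n)
    then obtain P where P: "\<forall>i\<in>{1..n}. primeideal (P i) R" "\<forall>i\<in>{1..<n}. P i \<subseteq> P (Suc i)"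
      "\<forall>i\<in>{1..n}. I i \<subseteq> P i \<and> M i \<inter> P i = {}" "ideal (P n) R" "P n \<inter> ?S (Suc n) = {}"
      by auto
    have "[Suc n..<Suc l] = Suc n # [Suc (Suc n)..<Suc l]"
      using Suc.prems by (intro upt_conv_Cons) simp
    with P(5) have disj: "P n \<inter> extension R (M (Suc n)) (I (Suc n)) (?S (Suc (Suc n))) = {}"
      by (simp del: upt_Suc)
    have "submonoid (?S (Suc (Suc n))) R"
      by (rule nested_values_submonoid) (auto intro: I M)
    then obtain Q where Q: "primeideal Q R" "P n \<subseteq> Q" "I (Suc n) \<subseteq> Q" "Q \<inter> M (Suc n) = {}"
      "Q \<inter> ?S (Suc (Suc n)) = {}"
      using exists_primeideal_step[OF P(4) I M _ disj] Suc.prems by auto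
    have less: "i \<in> {1..n} \<or> i = Suc n" if "i \<in> {1..Suc n}" for i
      using that by auto
    show ?case
      using P Q less primeideal.axioms(1)[OF Q(1)]
      by (intro exI[of _ "P(Suc n := Q)"]) (auto simp: less_Suc_eq simp del: upt_Suc)
  qed
  from this[of l] show ?thesis by auto
qed

text \<open>The induction starts at \<open>l\<close> because \<open>P (Suc l)\<close> is unspecified; there the inner values \<open>{1}\<close> avoid
  \<open>P l\<close> because a prime ideal is proper.\<close>

lemma (in cring) primeideal_chain_disjoint_nested_values:
  assumes P: "\<And>i. i \<in> {1..l} \<Longrightarrow> primeideal (P i) R"
    and chain: "\<And>i. i \<in> {1..<l} \<Longrightarrow> P i \<subseteq> P (Suc i)"
    and I: "\<And>i. i \<in> {1..l} \<Longrightarrow> ideal (I i) R" "\<And>i. i \<in> {1..l} \<Longrightarrow> I i \<subseteq> P i"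
    and M: "\<And>i. i \<in> {1..l} \<Longrightarrow> submonoid (M i) R" "\<And>i. i \<in> {1..l} \<Longrightarrow> M i \<inter> P i = {}"
    and k: "1 \<le> k" "k \<le> l"
  shows "nested_values R M I [k..<Suc l] \<inter> P k = {}"
proof -
  let ?S = "\<lambda>i. nested_values R M I [i..<Suc l]"
  have down: "?S i \<inter> P i = {}" if i: "i \<in> {1..l}" and d: "?S (Suc i) \<inter> P i = {}" for i
  proof -
    interpret P: primeideal "P i" R using i by (rule P)
    have "submonoid (?S (Suc i)) R"
      by (rule nested_values_submonoid) (auto intro: I(1) M(1))
    then have "extension R (M i) (I i) (?S (Suc i)) \<inter> P i = {}"
      using M[OF i] I(2)[OF i] d
      by (intro P.extension_disjoint_primeideal) (auto simp: submonoid_def)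
    moreover have "[i..<Suc l] = i # [Suc i..<Suc l]"
      using i by (intro upt_conv_Cons) simp
    ultimately show ?thesis by (simp del: upt_Suc)
  qed
  show ?thesis
    using k(2,1)
  proof (induction k rule: inc_induct)
    case base
    interpret P: primeideal "P l" R using P base by simp
    have "\<one> \<notin> P l" using P.I_notcarr P.one_imp_carrier by blast
    then show ?case using base by (intro down) auto
  next
    case (step n)
    then have "?S (Suc n) \<inter> P n = {}" using chain[of n] by (auto simp del: upt_Suc)
    then show ?case using step.hyps step.prems by (intro down) auto
  qed
qed

theorem mainTheorem2:
  fixes A :: "('a, 'b) ring_scheme" and l :: nat and J U :: "nat \<Rightarrow> 'a set"
  assumes "cring A"
    and "l \<ge> 1"
    and "\<And>i. i \<in> {1..l} \<Longrightarrow> J i \<subseteq> carrier A"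
    and "\<And>i. i \<in> {1..l} \<Longrightarrow> U i \<subseteq> carrier A"
  shows
    "(\<nexists>P :: nat \<Rightarrow> 'a set.
        (\<forall>i\<in>{1..l}. primeideal (P i) A) \<and>
        (\<forall>i\<in>{1..<l}. P i \<subseteq> P (Suc i)) \<and>
        (\<forall>i\<in>{1..l}. J i \<subseteq> P i \<and> U i \<inter> P i = {}))
     \<longleftrightarrow>
     (\<exists>j u :: nat \<Rightarrow> 'a.
        (\<forall>i\<in>{1..l}. j i \<in> Idl\<^bsub>A\<^esub> (J i) \<and> u i \<in> genmonoid A (U i)) \<and>
        nested A u j l = \<zero>\<^bsub>A\<^esub>)"
proof -
  interpret A: cring A by fact
  define I where "I i = Idl\<^bsub>A\<^esub> (J i)" for i
  define M where "M i = genmonoid A (U i)" for i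
  have I: "ideal (I i) A" "J i \<subseteq> I i" if "i \<in> {1..l}" for i
    unfolding I_def using assms(3)[OF that] by (rule A.genideal_ideal A.genideal_self)+
  have M: "submonoid (M i) A" if "i \<in> {1..l}" for i
    unfolding M_def using assms(4)[OF that] by (rule A.genmonoid_submonoid)
  have "(\<exists>j u. (\<forall>i\<in>{1..l}. j i \<in> I i \<and> u i \<in> M i) \<and> nested A u j l = \<zero>\<^bsub>A\<^esub>)
      \<longleftrightarrow> (\<exists>j u. (\<forall>i\<in>{1..l}. j i \<in> I i \<and> u i \<in> M i) \<and>
        \<zero>\<^bsub>A\<^esub> = foldr (\<lambda>i x. (u i \<otimes>\<^bsub>A\<^esub> x) \<oplus>\<^bsub>A\<^esub> j i) [1..<Suc l] \<one>\<^bsub>A\<^esub>)"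
  proof (intro ex_cong1 conj_cong refl)
    fix j u assume "\<forall>i\<in>{1..l}. j i \<in> I i \<and> u i \<in> M i"
    then have "u l \<in> carrier A"
      using M[of l] assms(2) by (auto simp: submonoid_def)
    then show "nested A u j l = \<zero>\<^bsub>A\<^esub> \<longleftrightarrow>
        \<zero>\<^bsub>A\<^esub> = foldr (\<lambda>i x. (u i \<otimes>\<^bsub>A\<^esub> x) \<oplus>\<^bsub>A\<^esub> j i) [1..<Suc l] \<one>\<^bsub>A\<^esub>"
      using A.nested_eq_foldr_one[OF assms(2)] by auto
  qed
  also have "\<dots> \<longleftrightarrow> \<zero>\<^bsub>A\<^esub> \<in> nested_values A M I [1..<Suc l]"
    by (simp add: nested_values_iff atLeastLessThanSuc_atLeastAtMost del: upt_Suc)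
  finally have b: "(\<exists>j u. (\<forall>i\<in>{1..l}. j i \<in> I i \<and> u i \<in> M i) \<and> nested A u j l = \<zero>\<^bsub>A\<^esub>)
      \<longleftrightarrow> \<zero>\<^bsub>A\<^esub> \<in> nested_values A M I [1..<Suc l]" .
  have "(\<exists>P. (\<forall>i\<in>{1..l}. primeideal (P i) A) \<and> (\<forall>i\<in>{1..<l}. P i \<subseteq> P (Suc i)) \<and>
        (\<forall>i\<in>{1..l}. J i \<subseteq> P i \<and> U i \<inter> P i = {}))
      \<longleftrightarrow> \<zero>\<^bsub>A\<^esub> \<notin> nested_values A M I [1..<Suc l]" (is "?chain \<longleftrightarrow> _")
  proof
    assume ?chain
    then obtain P where P: "\<And>i. i \<in> {1..l} \<Longrightarrow> primeideal (P i) A"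
      "\<And>i. i \<in> {1..<l} \<Longrightarrow> P i \<subseteq> P (Suc i)"
      "\<And>i. i \<in> {1..l} \<Longrightarrow> J i \<subseteq> P i" "\<And>i. i \<in> {1..l} \<Longrightarrow> U i \<inter> P i = {}"
      by blast
    have "I i \<subseteq> P i" if "i \<in> {1..l}" for i
      unfolding I_def using P(1,3)[OF that] by (intro A.genideal_minimal primeideal.axioms(1))
    moreover have "M i \<inter> P i = {}" if "i \<in> {1..l}" for i
      unfolding M_def using P(1)[OF that] assms(4)[OF that] P(4)[OF that]
      by (rule primeideal.genmonoid_disjoint)
    ultimately have "nested_values A M I [1..<Suc l] \<inter> P 1 = {}"
      using P(1,2) I(1) M assms(2)
      by (intro A.primeideal_chain_disjoint_nested_values) auto
    moreover have "\<zero>\<^bsub>A\<^esub> \<in> P 1"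
      using P(1)[of 1] assms(2)
      by (simp add: primeideal.axioms(1) ideal.axioms(1) additive_subgroup.zero_closed)
    ultimately show "\<zero>\<^bsub>A\<^esub> \<notin> nested_values A M I [1..<Suc l]" by blast
  next
    assume "\<zero>\<^bsub>A\<^esub> \<notin> nested_values A M I [1..<Suc l]"
    then obtain P where P: "\<forall>i\<in>{1..l}. primeideal (P i) A" "\<forall>i\<in>{1..<l}. P i \<subseteq> P (Suc i)"
      "\<forall>i\<in>{1..l}. I i \<subseteq> P i \<and> M i \<inter> P i = {}"
      using A.exists_primeideal_chain[of l I M] I(1) M by blast
    moreover have "U i \<subseteq> M i" for i
      unfolding M_def by (rule genmonoid_superset)
    ultimately show ?chain
      using I(2) by (intro exI[of _ P]) blast
  qed
  with b show ?thesis
    unfolding I_def M_def by blast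
qed

end
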